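(* For every integer $n\ge 10$ there exists a simple undirected graph $G$ on $n$ vertices that contains the complete graph $K_{n-2}$ as an induced subgraph and satisfies $\mathrm{mr}(\mathbb{F}_3,G)>3$.
   Context: $\mathbb{F}_3$ is the field with three elements. For a field $\mathbb{F}$ and a simple undirected graph $G$ with vertex set $\{1,\ldots,n\}$ and edge set $E$, let $\mathrm{S}(\mathbb{F},G)$ denote the set of all symmetric $n\times n$ matrices $A=[a_{ij}]$ over $\mathbb{F}$ such that, for all $i\neq j$, $a_{ij}\neq 0$ if and only if $ij\in E$; there is no restriction on the diagonal entries. The minimum rank of $G$ over $\mathbb{F}$ is $\mathrm{mr}(\mathbb{F},G)=\min\{\operatorname{rank}A : A\in \mathrm{S}(\mathbb{F},G)\}$. *)

theory Defs
  imports
    "Berlekamp_Zassenhaus.Finite_Field"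
    "Jordan_Normal_Form.DL_Rank"
    "Graph_Theory.Graph_Theory"
begin

text \<open>
  The field with three elements is the library's prime field \<open>'a mod_ring\<close>, i.e. the integers
  modulo \<open>CARD('a)\<close>, over an index type with three elements.
\<close>

typedef three = "{0..<3::nat}" by (rule exI[of _ 0]) simp

lemma card_three: "CARD(three) = 3"
  unfolding type_definition.card[OF type_definition_three] by simp

instance three :: prime_card
  by standard (simp add: card_three)

type_synonym F3 = "three mod_ring"

lemma card_F3: "CARD(F3) = 3"
  by (simp add: card_three)

text \<open>
  A simple undirected graph on \<open>n\<close> vertices is a \<open>pair_graph\<close> (a finite, loop-free digraph without
  parallel arcs whose arc relation is symmetric) with vertex set \<open>{0..<n}\<close>, rather than
  \<open>{1..n}\<close>, so that the vertices are the row and column indices of a matrix.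
  Both definitions below are only meaningful for such graphs.
\<close>

definition graph_mats :: "nat pair_pre_digraph \<Rightarrow> 'f::field mat set" where
  "graph_mats G = (let n = card (pverts G) in
     {A \<in> carrier_mat n n. transpose_mat A = A \<and>
        (\<forall>i<n. \<forall>j<n. i \<noteq> j \<longrightarrow> (A $$ (i, j) \<noteq> 0 \<longleftrightarrow> (i, j) \<in> parcs G))})"

text \<open>
  The first argument only carries the field.  \<open>Inf\<close> on \<^typ>\<open>nat\<close> is the least element of a nonempty
  set; lemma \<open>min_rank_attained\<close> confirms that the minimum is attained.
\<close>

definition min_rank :: "'f::field itself \<Rightarrow> nat pair_pre_digraph \<Rightarrow> nat" where
  "min_rank F G = Inf (vec_space.rank (card (pverts G)) ` (graph_mats G :: 'f mat set))"

lemma graph_mats_nonempty: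
  assumes "pair_graph G"
  shows "(graph_mats G :: 'f::field mat set) \<noteq> {}"
proof -
  interpret pair_graph G by fact
  let ?n = "card (pverts G)"
  let ?A = "mat ?n ?n (\<lambda>(i, j). if (i, j) \<in> parcs G then 1 else 0) :: 'f mat"
  have "(i, j) \<in> parcs G \<longleftrightarrow> (j, i) \<in> parcs G" for i j
    using pair_sym_arcs by (auto simp: symmetric_def sym_def)
  then have "?A \<in> graph_mats G"
    unfolding graph_mats_def Let_def by (auto intro!: eq_matI)
  then show ?thesis by blast
qed

lemma min_rank_attained:
  assumes "pair_graph G"
  shows "\<exists>A \<in> (graph_mats G :: 'f::field mat set).
    vec_space.rank (card (pverts G)) A = min_rank TYPE('f) G"
  using Inf_nat_def1[of "vec_space.rank (card (pverts G)) ` (graph_mats G :: 'f mat set)"]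
    graph_mats_nonempty[OF assms, where 'f = 'f]
  unfolding min_rank_def by (auto simp: image_iff)

end

theory Submission
  imports Defs
begin

text \<open>
  Join \<open>u\<close> and \<open>v\<close>, themselves nonadjacent, to a clique in which each of the four patterns of
  adjacency to \<open>u\<close> and \<open>v\<close> occurs at least twice, and suppose that the matrix has rank at most 3.
  For a clique vertex \<open>p\<close> adjacent to neither \<open>u\<close> nor \<open>v\<close>, the rows of \<open>u\<close>, \<open>v\<close> and \<open>p\<close> are a
  basis of the row space. So, up to scaling, the entry of two clique vertices \<open>i\<close>, \<open>j\<close> is
  \<open>1 + B (w i) (w j)\<close> with \<open>B\<close> a nondegenerate symmetric bilinear form on the plane and \<open>w i\<close> the
  pair of entries of \<open>i\<close> in the columns of \<open>u\<close> and \<open>v\<close>. Over the field with three elements, the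
  vectors \<open>w i\<close> of the remaining six vertices cannot all avoid \<open>B (w i) (w j) = -1\<close>
  for \<open>i \<noteq> j\<close>.
\<close>

section \<open>Linear algebra: symmetric matrices of rank at most three\<close>

lemma (in vec_space) mem_span_of_rank_le_card:
  assumes A: "A \<in> carrier_mat n nc" and S: "S \<subseteq> set (cols A)" "lin_indpt S"
    and rank: "rank A \<le> card S" and w: "w \<in> set (cols A)"
  shows "w \<in> span S"
proof (rule ccontr)
  assume nsp: "w \<notin> span S"
  have car: "set (cols A) \<subseteq> carrier_vec n"
    using A cols_dim by blast
  then have Sc: "S \<subseteq> carrier_vec n" and wc: "w \<in> carrier_vec n"
    using S w by auto
  have wS: "w \<notin> S"
    using nsp span_mem[OF Sc] by blast
  \<comment> \<open>Outside the span, \<open>w\<close> would enlarge \<open>S\<close> to an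
    independent set of columns with more than \<open>rank A\<close> elements.\<close>
  have "lin_indpt (insert w S)"
    using lin_dep_iff_in_span[OF Sc S(2) wc wS] nsp by simp
  then have "card (insert w S) \<le> rank A"
    using rank_ge_card_indpt[OF A] S w by simp
  moreover have "finite S"
    using S(1) finite_subset by blast
  ultimately show False
    using rank wS by simp
qed

text \<open>At the positions \<open>q\<close>, \<open>s\<close>, \<open>t\<close>, the rows
  \<open>p\<close>, \<open>u\<close>, \<open>v\<close>, in this order, form an upper triangular
  block with nonzero diagonal. So they are independent, and the rank bound makes them span. The
  proof uses columns, which symmetry identifies with rows.\<close>

lemma symmetric_row_combination:
  fixes A :: "'f::field mat"
  assumes A: "A \<in> carrier_mat n n" and sym: "\<And>i j. i < n \<Longrightarrow> j < n \<Longrightarrow> A $$ (i, j) = A $$ (j, i)"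
    and rank: "vec_space.rank n A \<le> 3"
    and n: "u < n" "v < n" "p < n" "q < n" "s < n" "t < n" "i < n"
    and u: "A $$ (u, q) = 0" "A $$ (u, s) \<noteq> 0" "A $$ (u, t) = 0"
    and v: "A $$ (v, q) = 0" "A $$ (v, s) = 0" "A $$ (v, t) \<noteq> 0"
    and p: "A $$ (p, q) \<noteq> 0"
  shows "\<exists>x y z. \<forall>j<n. A $$ (i, j) = x * A $$ (u, j) + y * A $$ (v, j) + z * A $$ (p, j)"
proof -
  interpret vec_space "TYPE('f)" n .
  let ?S = "{col A u, col A v, col A p}"
  have at: "col A k $ j = A $$ (k, j)" if "k < n" "j < n" for k j
    using that A sym by simp
  have ne: "col A u \<noteq> col A v" "col A u \<noteq> col A p" "col A v \<noteq> col A p"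
    using at n u v p by metis+
  have Sc: "?S \<subseteq> carrier_vec n"
    using A n by auto
  have lc: "lincomb f ?S $ j
      = f (col A u) * A $$ (u, j) + f (col A v) * A $$ (v, j) + f (col A p) * A $$ (p, j)"
    if "j < n" for f j
    using that ne n by (simp add: lincomb_index[OF _ Sc] at add.assoc del: index_col)
  have "lin_indpt ?S"
  proof (rule finite_lin_indpt2)
    fix f assume "lincomb f ?S = 0\<^sub>v n"
    then have z: "f (col A u) * A $$ (u, j) + f (col A v) * A $$ (v, j) + f (col A p) * A $$ (p, j) = 0"
      if "j < n" for j
      using lc[OF that, of f] that by simp
    have "f (col A p) = 0"
      using z[of q] n u v p by simp
    then show "\<forall>w\<in>?S. f w = 0"
      using z[of s] z[of t] n u v by simp
  qed (use Sc in auto)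
  moreover have cols: "col A k \<in> set (cols A)" if "k < n" for k
    using that A by (auto simp: cols_def)
  moreover have "card ?S = 3"
    using ne by simp
  ultimately have "col A i \<in> span ?S"
    using mem_span_of_rank_le_card[OF A, of ?S "col A i"] rank n by simp
  then obtain f where "lincomb f ?S = col A i"
    using finite_in_span[OF _ Sc, of "col A i"] by auto
  then have "A $$ (i, j)
      = f (col A u) * A $$ (u, j) + f (col A v) * A $$ (v, j) + f (col A p) * A $$ (p, j)"
    if "j < n" for j
    using lc[OF that, of f] at[OF n(7) that] by simp
  then show ?thesis
    by blast
qed

text \<open>By symmetry, the coefficients of row \<open>i\<close> can be recovered from its entries
  in the columns \<open>u\<close>, \<open>v\<close>, \<open>p\<close>. The matrix of the form, with
  diagonal \<open>a\<close>, \<open>b\<close> and off-diagonal entry \<open>c\<close>, is the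
  inverse of the block of \<open>A\<close> on \<open>u\<close>, \<open>v\<close>.\<close>

lemma symmetric_rank_3_entries:
  fixes A :: "'f::field mat"
  assumes A: "A \<in> carrier_mat n n" and sym: "\<And>i j. i < n \<Longrightarrow> j < n \<Longrightarrow> A $$ (i, j) = A $$ (j, i)"
    and rank: "vec_space.rank n A \<le> 3"
    and n: "u < n" "v < n" "p < n" "q < n" "s < n" "t < n"
    and u: "A $$ (u, p) = 0" "A $$ (u, q) = 0" "A $$ (u, s) \<noteq> 0" "A $$ (u, t) = 0"
    and v: "A $$ (v, p) = 0" "A $$ (v, q) = 0" "A $$ (v, s) = 0" "A $$ (v, t) \<noteq> 0"
    and p: "A $$ (p, q) \<noteq> 0"
  shows "\<exists>a b c d z. a * b \<noteq> c * c \<and> (\<forall>i<n. \<forall>j<n. A $$ (i, j) = d * z i * z j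
      + a * A $$ (u, i) * A $$ (u, j)
      + c * (A $$ (u, i) * A $$ (v, j) + A $$ (v, i) * A $$ (u, j))
      + b * A $$ (v, i) * A $$ (v, j))"
proof -
  have "\<forall>i. \<exists>x y z. i < n \<longrightarrow>
      (\<forall>j<n. A $$ (i, j) = x * A $$ (u, j) + y * A $$ (v, j) + z * A $$ (p, j))"
    using symmetric_row_combination[OF A sym rank n _ u(2-4) v(2-4) p] by blast
  then obtain x y z where row: "A $$ (i, j) = x i * A $$ (u, j) + y i * A $$ (v, j) + z i * A $$ (p, j)"
    if "i < n" "j < n" for i j
    by metis
  define \<alpha> \<beta> \<gamma> \<delta> where "\<alpha> = A $$ (u, u)" and "\<beta> = A $$ (v, v)" and "\<gamma> = A $$ (u, v)"
    and "\<delta> = A $$ (p, p)"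
  have zero: "A $$ (p, u) = 0" "A $$ (p, v) = 0" and \<gamma>: "A $$ (v, u) = \<gamma>"
    using sym n u(1) v(1) by (auto simp: \<gamma>_def)
  \<comment> \<open>Row \<open>p\<close> vanishes at \<open>u\<close> and \<open>v\<close>, so the
    block of \<open>A\<close> on \<open>u\<close>, \<open>v\<close> maps \<open>(x i, y i)\<close>
    to the entries of \<open>i\<close> there. \<open>X\<close> and \<open>Y\<close> below are
    Cramer's rule.\<close>
  have U: "A $$ (u, i) = x i * \<alpha> + y i * \<gamma>" if "i < n" for i
    using row[OF that n(1)] sym[OF that n(1)] zero by (simp add: \<alpha>_def \<gamma>)
  have V: "A $$ (v, i) = x i * \<gamma> + y i * \<beta>" if "i < n" for i
    using row[OF that n(2)] sym[OF that n(2)] zero by (simp add: \<beta>_def \<gamma>_def)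
  have P: "A $$ (p, i) = z i * \<delta>" if "i < n" for i
    using row[OF that n(3)] sym[OF that n(3)] u(1) v(1) by (simp add: \<delta>_def)
  define D where "D = \<alpha> * \<beta> - \<gamma> * \<gamma>"
  have X: "D * x i = \<beta> * A $$ (u, i) - \<gamma> * A $$ (v, i)" if "i < n" for i
    by (simp add: U V that D_def algebra_simps)
  have Y: "D * y i = \<alpha> * A $$ (v, i) - \<gamma> * A $$ (u, i)" if "i < n" for i
    by (simp add: U V that D_def algebra_simps)
  \<comment> \<open>If the block were singular, Cramer's rule at \<open>t\<close>, where only row
    \<open>v\<close> is nonzero, would give \<alpha> = \<gamma> = 0, and then row \<open>u\<close>
    would vanish at \<open>s\<close>.\<close>
  have D: "D \<noteq> 0"
  proof
    assume "D = 0"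
    then have "\<alpha> = 0" "\<gamma> = 0"
      using X[OF n(6)] Y[OF n(6)] u v by auto
    then show False
      using U[OF n(5)] u by simp
  qed
  have x: "x i = \<beta> / D * A $$ (u, i) + - \<gamma> / D * A $$ (v, i)" if "i < n" for i
    using X[OF that] D by (simp add: field_simps)
  have y: "y i = \<alpha> / D * A $$ (v, i) + - \<gamma> / D * A $$ (u, i)" if "i < n" for i
    using Y[OF that] D by (simp add: field_simps)
  have "\<beta> / D * (\<alpha> / D) - - \<gamma> / D * (- \<gamma> / D) = D / (D * D)"
    by (simp add: D_def diff_divide_distrib mult.commute)
  then have "\<beta> / D * (\<alpha> / D) \<noteq> - \<gamma> / D * (- \<gamma> / D)"
    using D by auto
  moreover have "A $$ (i, j) = \<delta> * z i * z j
      + \<beta> / D * A $$ (u, i) * A $$ (u, j)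
      + - \<gamma> / D * (A $$ (u, i) * A $$ (v, j) + A $$ (v, i) * A $$ (u, j))
      + \<alpha> / D * A $$ (v, i) * A $$ (v, j)" if "i < n" "j < n" for i j
    unfolding row[OF that] P[OF that(2)] x[OF that(1)] y[OF that(1)] by (simp add: algebra_simps)
  ultimately show ?thesis
    by blast
qed

section \<open>Arithmetic in the field with three elements\<close>

lemma F3_three: "(3 :: F3) = 0"
  using of_nat_card_eq_0[where 'a = three] by (simp add: card_three)

lemma F3_cases:
  fixes x :: F3
  obtains "x = 0" | "x = 1" | "x = -1"
proof -
  obtain i where "i < 3" "x = of_nat i"
    using surj_of_nat_mod_ring[of x] card_three by auto
  then have "x = 0 \<or> x = 1 \<or> x = 2"
    by (auto simp: less_Suc_eq numeral_3_eq_3)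
  moreover have "(2 :: F3) = - 1"
    using F3_three by (simp add: eq_neg_iff_add_eq_0)
  ultimately show thesis
    using that by auto
qed

text \<open>The vectors are \<open>(s, 0)\<close>, \<open>(s', 0)\<close>, \<open>(0, t)\<close>,
  \<open>(0, t')\<close>, \<open>(x, y)\<close>, \<open>(x', y')\<close>. Nonzero scalars are signs,
  so excluding the value -1 fixes signs until the last two vectors coincide, and their common value
  under the form is -1.\<close>

lemma F3_bilinear_values:
  fixes a b c :: F3
  assumes det: "a * b \<noteq> c * c"
    and nz: "s \<noteq> 0" "s' \<noteq> 0" "t \<noteq> 0" "t' \<noteq> 0" "x \<noteq> 0" "y \<noteq> 0" "x' \<noteq> 0" "y' \<noteq> 0"
    and ss: "1 + a * s * s' \<noteq> 0" and tt: "1 + b * t * t' \<noteq> 0"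
    and st: "1 + c * s * t \<noteq> 0" "1 + c * s * t' \<noteq> 0" "1 + c * s' * t \<noteq> 0" "1 + c * s' * t' \<noteq> 0"
    and sx: "1 + a * s * x + c * s * y \<noteq> 0" "1 + a * s' * x + c * s' * y \<noteq> 0"
      "1 + a * s * x' + c * s * y' \<noteq> 0" "1 + a * s' * x' + c * s' * y' \<noteq> 0"
    and tx: "1 + c * t * x + b * t * y \<noteq> 0" "1 + c * t' * x + b * t' * y \<noteq> 0"
      "1 + c * t * x' + b * t * y' \<noteq> 0" "1 + c * t' * x' + b * t' * y' \<noteq> 0"
    and xx: "1 + a * x * x' + c * (x * y' + y * x') + b * y * y' \<noteq> 0"
  shows False
proof -
  have two: "(2 :: F3) = - 1"
    using F3_three by (simp add: eq_neg_iff_add_eq_0)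
  have sgn: "w = 1 \<or> w = - 1" if "w \<noteq> 0" for w :: F3
    using that by (cases w rule: F3_cases) auto
  have ne: "(1 :: F3) \<noteq> - 1" "(- 1 :: F3) \<noteq> 1"
    using two by (metis add.right_inverse neg_equal_0_iff_equal one_add_one zero_neq_one)+
  have ssv: "s' = s \<and> (a = 0 \<or> a = 1) \<or> s' = - s \<and> (a = 0 \<or> a = - 1)"
    using sgn[OF nz(1)] sgn[OF nz(2)] ss by (cases a rule: F3_cases) (auto simp: two F3_three ne)
  have ttv: "t' = t \<and> (b = 0 \<or> b = 1) \<or> t' = - t \<and> (b = 0 \<or> b = - 1)"
    using sgn[OF nz(3)] sgn[OF nz(4)] tt by (cases b rule: F3_cases) (auto simp: two F3_three ne)
  show False
  proof (cases "c = 0")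
    case True
    \<comment> \<open>Nondegeneracy gives \<open>a \<noteq> 0\<close>. If \<open>s' = - s\<close>,
      one of \<open>a * s * x\<close> and \<open>a * s' * x\<close> would be -1.\<close>
    have a: "a = 1" and x: "x = s" "x' = s"
      using ssv sgn[OF nz(1)] sgn[OF nz(5)] sgn[OF nz(7)] sx det True by (auto simp: two F3_three ne)
    have b: "b = 1" and y: "y = t" "y' = t"
      using ttv sgn[OF nz(3)] sgn[OF nz(6)] sgn[OF nz(8)] tx det True by (auto simp: two F3_three ne)
    show False
      \<comment> \<open>Both vectors are \<open>(s, t)\<close>, and 1 + s*s + t*t = 3 = 0.\<close>
      using xx sgn[OF nz(1)] sgn[OF nz(3)] by (auto simp: a b x y True two F3_three ne)
  next
    case False
    \<comment> \<open>The four products in \<open>st\<close> are signs other than -1, hence all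
      equal 1.\<close>
    have c: "c = s * t" and s': "s' = s" and t': "t' = t"
      using sgn[OF nz(1)] sgn[OF nz(2)] sgn[OF nz(3)] sgn[OF nz(4)] sgn[OF False] st
      by (auto simp: two F3_three ne)
    then have ab: "a = 0 \<or> a = 1" "b = 0 \<or> b = 1" "a = 0 \<or> b = 0"
      using ssv ttv det nz sgn[OF nz(1)] sgn[OF nz(3)] by auto
    \<comment> \<open>With X = s*x and Y = t*y, \<open>sx\<close> and \<open>tx\<close> say that 1 +
      a*X + Y and 1 + X + b*Y are nonzero. This forces (X, Y) to be (1, 1), (-1, 1) or (1, -1) when
      (a, b) is (0, 0), (0, 1) or (1, 0). The same holds for \<open>x'\<close>, \<open>y'\<close>,
      and \<open>xx\<close> fails in each case.\<close>
    show False
      using sgn[OF nz(1)] sgn[OF nz(3)] sgn[OF nz(5)] sgn[OF nz(6)] sgn[OF nz(7)] sgn[OF nz(8)]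
        ab sx tx xx
      unfolding c s' t' by (elim disjE) (simp_all add: two F3_three ne)
  qed
qed

section \<open>The graph and its minimum rank\<close>

text \<open>Vertices 0 and 1 are \<open>u\<close> and \<open>v\<close>; the clique vertices from 10 on only pad the graph.\<close>

definition clique_plus_two :: "nat \<Rightarrow> nat pair_pre_digraph" where
  "clique_plus_two n = \<lparr>pverts = {0..<n}, parcs = {(i, j). i < n \<and> j < n \<and> i \<noteq> j \<and>
     (2 \<le> i \<and> 2 \<le> j
      \<or> i = 0 \<and> j \<in> {4, 5, 8, 9} \<or> i \<in> {4, 5, 8, 9} \<and> j = 0
      \<or> i = 1 \<and> j \<in> {6, 7, 8, 9} \<or> i \<in> {6, 7, 8, 9} \<and> j = 1)}\<rparr>"

lemma pair_graph_clique_plus_two: "pair_graph (clique_plus_two n)"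
proof unfold_locales
  have "parcs (clique_plus_two n) \<subseteq> {0..<n} \<times> {0..<n}"
    by (auto simp: clique_plus_two_def)
  then show "finite (parcs (clique_plus_two n))"
    using finite_subset by blast
  show "symmetric (with_proj (clique_plus_two n))"
    unfolding symmetric_def sym_def by (auto simp: clique_plus_two_def)
qed (auto simp: clique_plus_two_def)

lemma clique_plus_two_induced:
  "\<exists>H. induced_subgraph (with_proj H) (with_proj (clique_plus_two n)) \<and>
     complete_digraph (n - 2) (with_proj H)"
proof -
  define H :: "nat pair_pre_digraph" where
    "H = \<lparr>pverts = {2..<n}, parcs = {(i, j). i \<in> {2..<n} \<and> j \<in> {2..<n} \<and> i \<noteq> j}\<rparr>"
  interpret G: pair_graph "clique_plus_two n"
    by (rule pair_graph_clique_plus_two)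
  have "pair_graph H"
  proof unfold_locales
    have "parcs H \<subseteq> {2..<n} \<times> {2..<n}"
      by (auto simp: H_def)
    then show "finite (parcs H)"
      using finite_subset by blast
    show "symmetric (with_proj H)"
      unfolding symmetric_def sym_def by (auto simp: H_def)
  qed (auto simp: H_def)
  then interpret H: pair_graph H .
  have "complete_digraph (n - 2) (with_proj H)"
    unfolding complete_digraph_def using H.graph_axioms by (auto simp: H_def)
  moreover have "induced_subgraph (with_proj H) (with_proj (clique_plus_two n))"
    unfolding induced_subgraph_def subgraph_def compatible_def
    using G.wf_digraph_axioms H.wf_digraph_axioms
    by (auto simp: H_def clique_plus_two_def)
  ultimately show ?thesis
    by blast
qed

lemma rank_clique_plus_two:
  fixes A :: "F3 mat"
  assumes n: "n \<ge> 10" and A: "A \<in> graph_mats (clique_plus_two n)"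
  shows "vec_space.rank n A > 3"
proof (rule ccontr)
  assume "\<not> vec_space.rank n A > 3"
  then have rank: "vec_space.rank n A \<le> 3"
    by simp
  have car: "A \<in> carrier_mat n n" and tr: "transpose_mat A = A"
    using A by (auto simp: graph_mats_def clique_plus_two_def)
  have adj: "A $$ (i, j) = 0 \<longleftrightarrow> (i, j) \<notin> parcs (clique_plus_two n)"
    if "i < n" "j < n" "i \<noteq> j" for i j
    using A n that by (auto simp: graph_mats_def clique_plus_two_def)
  let ?U = "\<lambda>i. A $$ (0, i)" and ?V = "\<lambda>i. A $$ (1, i)"
  have sym: "A $$ (i, j) = A $$ (j, i)" if "i < n" "j < n" for i j
    using car tr that by (metis carrier_matD index_transpose_mat(1))
  have U: "?U 4 \<noteq> 0" "?U 5 \<noteq> 0" "?U 8 \<noteq> 0" "?U 9 \<noteq> 0" "?U 2 = 0" "?U 3 = 0" "?U 6 = 0" "?U 7 = 0"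
    using n adj[of 0] by (auto simp: clique_plus_two_def)
  have V: "?V 6 \<noteq> 0" "?V 7 \<noteq> 0" "?V 8 \<noteq> 0" "?V 9 \<noteq> 0" "?V 2 = 0" "?V 3 = 0" "?V 4 = 0" "?V 5 = 0"
    using n adj[of 1] by (auto simp: clique_plus_two_def)
  have clique: "A $$ (i, j) \<noteq> 0" if "2 \<le> i" "2 \<le> j" "i < n" "j < n" "i \<noteq> j" for i j
    using adj[of i j] that by (auto simp: clique_plus_two_def)
  have "\<exists>a b c d z. a * b \<noteq> c * c \<and> (\<forall>i<n. \<forall>j<n. A $$ (i, j) = d * z i * z j
      + a * ?U i * ?U j + c * (?U i * ?V j + ?V i * ?U j) + b * ?V i * ?V j)"
    \<comment> \<open>Vertices 2 and 3 are adjacent to neither \<open>u\<close> nor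
      \<open>v\<close>, vertex 4 only to \<open>u\<close> and vertex 6 only to
      \<open>v\<close>.\<close>
    by (rule symmetric_rank_3_entries[OF car sym rank, where p = 2 and q = 3 and s = 4 and t = 6])
      (use n U V clique[of 2 3] in simp_all)
  then obtain a b c d z where det: "a * b \<noteq> c * c"
    and entry: "\<And>i j. i < n \<Longrightarrow> j < n \<Longrightarrow> A $$ (i, j) = d * z i * z j
      + a * ?U i * ?U j + c * (?U i * ?V j + ?V i * ?U j) + b * ?V i * ?V j"
    by blast
  \<comment> \<open>Since \<open>?U 2\<close> and \<open>?V 2\<close> vanish, the entry at
    \<open>(2, i)\<close> is just \<open>d * z 2 * z i\<close>, and it is nonzero in the
    clique.\<close>
  have z: "d \<noteq> 0" "z i \<noteq> 0" if "3 \<le> i" "i < n" for i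
    using clique[of 2 i] entry[of 2 i] that U V by auto
  \<comment> \<open>Dividing by \<open>z i\<close>, and the form by \<open>d\<close>, normalizes the
    first term of every entry to 1.\<close>
  define f g where "f i = ?U i / z i" and "g i = ?V i / z i" for i
  have nz: "1 + a / d * f i * f j + c / d * (f i * g j + g i * f j) + b / d * g i * g j \<noteq> 0"
    if "i \<in> {4..9}" "j \<in> {4..9}" "i \<noteq> j" for i j
  proof -
    have zz: "d \<noteq> 0" "z i \<noteq> 0" "z j \<noteq> 0"
      using z[of i] z[of j] that n by auto
    have "A $$ (i, j) = d * z i * z j *
      (1 + a / d * f i * f j + c / d * (f i * g j + g i * f j) + b / d * g i * g j)"
      using entry[of i j] that n zz by (simp add: f_def g_def field_simps)
    moreover have "A $$ (i, j) \<noteq> 0"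
      using clique[of i j] that n by simp
    ultimately show ?thesis
      by auto
  qed
  have f: "f 4 \<noteq> 0" "f 5 \<noteq> 0" "f 8 \<noteq> 0" "f 9 \<noteq> 0" "f 6 = 0" "f 7 = 0"
    using U z n by (auto simp: f_def)
  have g: "g 6 \<noteq> 0" "g 7 \<noteq> 0" "g 8 \<noteq> 0" "g 9 \<noteq> 0" "g 4 = 0" "g 5 = 0"
    using V z n by (auto simp: g_def)
  have "d \<noteq> 0"
    using z[of 3] n by simp
  then have "a / d * (b / d) \<noteq> c / d * (c / d)"
    using det by simp
  \<comment> \<open>The fifteen instances of \<open>nz\<close> are all the pairs among the vertices
    4 to 9.\<close>
  then show False
    using F3_bilinear_values[of "a / d" "b / d" "c / d" "f 4" "f 5" "g 6" "g 7" "f 8" "g 8" "f 9" "g 9"]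
      f g nz[of 4 5] nz[of 6 7] nz[of 4 6] nz[of 4 7] nz[of 5 6] nz[of 5 7]
      nz[of 4 8] nz[of 5 8] nz[of 4 9] nz[of 5 9] nz[of 6 8] nz[of 7 8] nz[of 6 9] nz[of 7 9] nz[of 8 9]
    by (simp add: mult.assoc)
qed

theorem theorem4p2:
  fixes n :: nat
  assumes "n \<ge> 10"
  shows "\<exists>G :: nat pair_pre_digraph.
    pair_graph G \<and> pverts G = {0..<n} \<and>
    (\<exists>H :: nat pair_pre_digraph.
       induced_subgraph (with_proj H) (with_proj G) \<and> complete_digraph (n - 2) (with_proj H)) \<and>
    min_rank TYPE(F3) G > 3"
proof (rule exI[of _ "clique_plus_two n"], intro conjI)
  have card: "card (pverts (clique_plus_two n)) = n"
    by (simp add: clique_plus_two_def)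
  \<comment> \<open>The minimum is attained by some matrix of the graph, so the bound for each such
    matrix carries over.\<close>
  show "min_rank TYPE(F3) (clique_plus_two n) > 3"
    using min_rank_attained[OF pair_graph_clique_plus_two, where 'f = F3, of n]
      rank_clique_plus_two[OF assms] unfolding card by fastforce
  show "pverts (clique_plus_two n) = {0..<n}"
    by (simp add: clique_plus_two_def)
qed (rule pair_graph_clique_plus_two clique_plus_two_induced)+

end
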